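(* Let $\alpha\in\mathbb{C}$, and let $p\ge 0$ and $n\ge 1$ be integers with $p\le n$. Then $$\sum_{j=0}^n\binom{n}{j}j^pH_j(\alpha)(-1)^j=\sum_{l=0}^p\sum_{j=0}^p(-1)^l\binom{n}{l}\binom{n-l}{j-l}\,j!\,{p\brace j}\,\frac{1}{n-l}\left((1-\alpha)^{n-l}-1\right),$$ where, if $p=n$, the terms with $l=n$ are taken to be $0$.
   Context: For $\alpha\in\mathbb{C}$, the generalized harmonic numbers are $H_0(\alpha)=0$ and $H_k(\alpha)=\sum_{j=1}^k\frac{\alpha^j}{j}$ for $k\ge 1$. ${p\brace j}$ denotes the Stirling number of the second kind. Conventions: $\binom{n-l}{j-l}=0$ if $j<l$; $0^0=1$. *)

theory Defs
  imports Complex_Main "HOL-Combinatorics.Stirling"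
begin

definition gen_harm :: "complex \<Rightarrow> nat \<Rightarrow> complex" where
  "gen_harm \<alpha> k = (\<Sum>j = 1..k. \<alpha> ^ j / of_nat j)"

(* Truncated subtraction on nat would give (n - l) choose (j - l) = 1 for j < l,
   where the convention is that the coefficient vanishes. *)
definition shifted_binomial :: "nat \<Rightarrow> nat \<Rightarrow> nat \<Rightarrow> nat" where
  "shifted_binomial n j l = (if j < l then 0 else (n - l) choose (j - l))"

end

theory Submission
  imports Defs
begin

text \<open>
  Put \<open>x = 1 - \<alpha>\<close>. The harmonic number \<open>H\<^sub>j(\<alpha>)\<close> is the binomial transform of
  \<open>(x\<^sup>k - 1) / k\<close>, and \<open>j\<^sup>p\<close> is a combination of the binomial coefficients \<open>j choose m\<close>.
  Hence the coefficient of \<open>(x\<^sup>k - 1) / k\<close> on the left-hand side is governed by the sums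
  \<open>\<Sum>j. (-1)\<^sup>j (n choose j) (j choose k) (j choose m)\<close>. Absorbing \<open>j choose k\<close> into
  \<open>n choose j\<close> turns each of them into an iterated difference of \<open>i \<mapsto> (i + k) choose m\<close>,
  which has a closed form; the substitution \<open>k = n - l\<close> gives the right-hand side.
\<close>

text \<open>The summand for \<open>k = 0\<close> vanishes because \<open>0 / 0 = 0\<close>.\<close>

lemma gen_harm_binomial_transform:
  "gen_harm (1 - x) j = (\<Sum>k\<le>j. (- 1) ^ k * of_nat (j choose k) * ((x ^ k - 1) / of_nat k))"
proof (induction j)
  case 0
  then show ?case by (simp add: gen_harm_def)
next
  case (Suc j)
  have absorb: "of_nat (j choose k) / of_nat (Suc k) =
      (of_nat (Suc j choose Suc k) / of_nat (Suc j) :: complex)" for k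
  proof -
    have "of_nat (Suc k) * of_nat (Suc j choose Suc k) =
        (of_nat (Suc j) * of_nat (j choose k) :: complex)"
      using Suc_times_binomial_eq[of j k]
      by (metis mult.commute of_nat_mult)
    then show ?thesis
      by (simp add: divide_simps del: of_nat_Suc binomial_Suc_Suc) (simp add: mult.commute)
  qed
  let ?t = "\<lambda>k. (- 1) ^ k * ((x ^ k - 1) / of_nat k) :: complex"
  have binom: "(\<Sum>k\<le>Suc j. (- 1) ^ k * of_nat (Suc j choose k) * y ^ k) = (1 - y) ^ Suc j"
    for y :: complex
    using binomial_ring[of "- y" 1 "Suc j"]
    by (simp add: power_minus[of y] mult_ac del: binomial_Suc_Suc power_Suc sum.atMost_Suc)
  \<comment> \<open>The increment in \<open>j\<close> is computed: Pascal's rule leaves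
    \<open>j choose k\<close> against \<open>?t (Suc k)\<close>, and \<open>absorb\<close> trades
    the varying denominator \<open>Suc k\<close> for the constant \<open>Suc j\<close>, so that the
    binomial theorem applies.\<close>
  have "(\<Sum>k\<le>Suc j. of_nat (Suc j choose k) * ?t k) - (\<Sum>k\<le>j. of_nat (j choose k) * ?t k)
      = (\<Sum>k\<le>Suc j. of_nat (Suc j choose k) * ?t k) - (\<Sum>k\<le>Suc j. of_nat (j choose k) * ?t k)"
    by simp
  also have "\<dots> = (\<Sum>k\<le>j. of_nat (j choose k) * ?t (Suc k))"
    unfolding sum.atMost_Suc_shift
    by (simp add: sum_subtractf[symmetric] add_divide_distrib distrib_right
        del: sum.atMost_Suc of_nat_Suc power_Suc)
  also have "\<dots> = (\<Sum>k\<le>j. (- 1) ^ Suc k * (x ^ Suc k - 1) * (of_nat (j choose k) / of_nat (Suc k)))"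
    by (intro sum.cong) simp_all
  also have "\<dots> = (\<Sum>k\<le>j. (- 1) ^ Suc k * (x ^ Suc k - 1) *
      of_nat (Suc j choose Suc k)) / of_nat (Suc j)"
    unfolding absorb by (simp add: sum_divide_distrib del: of_nat_Suc power_Suc binomial_Suc_Suc)
  also have "(\<Sum>k\<le>j. (- 1) ^ Suc k * (x ^ Suc k - 1) * of_nat (Suc j choose Suc k)) =
      (\<Sum>k\<le>Suc j. (- 1) ^ k * (x ^ k - 1) * of_nat (Suc j choose k))"
    unfolding sum.atMost_Suc_shift by simp
  \<comment> \<open>The factor \<open>1 ^ k\<close> makes the second sum \<open>binom\<close> at
    \<open>y = 1\<close>, which is 0 because the exponent \<open>Suc j\<close> is positive.\<close>
  also have "\<dots> = (\<Sum>k\<le>Suc j. (- 1) ^ k * of_nat (Suc j choose k) * x ^ k) -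
      (\<Sum>k\<le>Suc j. (- 1) ^ k * of_nat (Suc j choose k) * 1 ^ k)"
    unfolding sum_subtractf[symmetric] by (intro sum.cong) (simp_all add: algebra_simps)
  also have "\<dots> = (1 - x) ^ Suc j"
    unfolding binom by simp
  finally have "(\<Sum>k\<le>Suc j. of_nat (Suc j choose k) * ?t k) =
      (\<Sum>k\<le>j. of_nat (j choose k) * ?t k) + (1 - x) ^ Suc j / of_nat (Suc j)"
    by (simp only: algebra_simps)
  moreover have "gen_harm (1 - x) (Suc j) = gen_harm (1 - x) j + (1 - x) ^ Suc j / of_nat (Suc j)"
    by (simp add: gen_harm_def del: of_nat_Suc power_Suc)
  ultimately show ?case
    using Suc.IH by (simp only: mult_ac)
qed

text \<open>Multiplying \<open>j choose m\<close> by \<open>j = m + (j - m)\<close> yields binomials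
  with lower index \<open>m\<close> and \<open>Suc m\<close>; collecting them reproduces the
  Stirling recurrence.\<close>

lemma power_eq_sum_Stirling_binomial:
  "j ^ p = (\<Sum>m\<le>p. Stirling p m * fact m * (j choose m))"
proof (induction p)
  case 0
  then show ?case by simp
next
  case (Suc p)
  have step: "j * (j choose m) = m * (j choose m) + Suc m * (j choose Suc m)" for m
  proof (cases "m \<le> j")
    case True
    have "Suc m * (j choose Suc m) = (j - m) * (j choose m)"
      by (metis binomial_absorb_comp binomial_absorption)
    with True show ?thesis
      by (metis add_mult_distrib le_add_diff_inverse)
  qed (simp add: binomial_eq_0)
  let ?b = "\<lambda>m. fact m * (j choose m) :: nat"
  have "j ^ Suc p = (\<Sum>m\<le>p. Stirling p m * fact m * (j * (j choose m)))"
    by (simp add: Suc.IH sum_distrib_left mult_ac)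
  also have "\<dots> = (\<Sum>m\<le>p. m * Stirling p m * ?b m) + (\<Sum>m\<le>p. Stirling p m * ?b (Suc m))"
    unfolding step sum.distrib[symmetric] by (intro sum.cong) (simp_all add: algebra_simps)
  \<comment> \<open>The added top term is 0 since \<open>Stirling p (Suc p) = 0\<close>, and the
    bottom one is 0 by the factor \<open>m\<close>, so the index can be shifted to match the other
    sum.\<close>
  also have "(\<Sum>m\<le>p. m * Stirling p m * ?b m) = (\<Sum>m\<le>Suc p. m * Stirling p m * ?b m)"
    by simp
  also have "\<dots> = (\<Sum>m\<le>p. Suc m * Stirling p (Suc m) * ?b (Suc m))"
    unfolding sum.atMost_Suc_shift by simp
  also have "\<dots> + (\<Sum>m\<le>p. Stirling p m * ?b (Suc m)) =
      (\<Sum>m\<le>p. Stirling (Suc p) (Suc m) * ?b (Suc m))"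
    unfolding sum.distrib[symmetric] by (intro sum.cong) (simp_all add: algebra_simps)
  also have "\<dots> = (\<Sum>m\<le>Suc p. Stirling (Suc p) m * ?b m)"
    unfolding sum.atMost_Suc_shift by simp
  finally show ?case by (simp only: mult.assoc)
qed

text \<open>Pascal's rule on \<open>Suc N choose i\<close>: an iterated difference of order
  \<open>Suc N\<close> is one of order \<open>N\<close> of \<open>f\<close> minus that of its
  shift.\<close>

lemma alternating_sum_choose_Suc:
  fixes f :: "nat \<Rightarrow> 'a::comm_ring_1"
  shows "(\<Sum>i\<le>Suc N. (- 1) ^ i * of_nat (Suc N choose i) * f i) =
    (\<Sum>i\<le>N. (- 1) ^ i * of_nat (N choose i) * f i) -
    (\<Sum>i\<le>N. (- 1) ^ i * of_nat (N choose i) * f (Suc i))"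
proof -
  have "(\<Sum>i\<le>N. (- 1) ^ i * of_nat (N choose i) * f i) =
      (\<Sum>i\<le>Suc N. (- 1) ^ i * of_nat (N choose i) * f i)"
    by (simp add: binomial_eq_0)
  then show ?thesis
    unfolding sum.atMost_Suc_shift by (simp add: algebra_simps sum.distrib sum_negf sum_subtractf)
qed

text \<open>Each difference lowers \<open>m\<close> by one and flips the sign, again by Pascal's
  rule. The shift of \<open>i\<close> is absorbed into \<open>k\<close>, hence the induction with
  \<open>k\<close> arbitrary.\<close>

lemma alternating_sum_choose_choose:
  "(\<Sum>i\<le>N. (- 1) ^ i * of_nat (N choose i) * of_nat ((i + k) choose m)) =
    ((- 1) ^ N * of_nat (if m < N then 0 else k choose (m - N)) :: 'a::comm_ring_1)"
proof (induction N arbitrary: k)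
  case 0
  then show ?case by simp
next
  case (Suc N)
  have IH: "(\<Sum>i\<le>N. (- 1) ^ i * of_nat (N choose i) * of_nat ((Suc i + k) choose m)) =
    ((- 1) ^ N * of_nat (if m < N then 0 else Suc k choose (m - N)) :: 'a)"
    using Suc.IH[of "Suc k"] by simp
  show ?case
  \<comment> \<open>For \<open>m = N\<close> both differences equal the same constant and cancel;
    for \<open>m < N\<close> both are 0.\<close>
  proof (cases "m \<le> N")
    case True
    then show ?thesis
      unfolding alternating_sum_choose_Suc IH Suc.IH by auto
  next
    case False
    then have "m - N = Suc (m - Suc N)" by simp
    with False show ?thesis
      unfolding alternating_sum_choose_Suc IH Suc.IH by (simp add: algebra_simps)
  qed
qed

lemma alternating_sum_three_choose:
  assumes "l \<le> n"
  shows "(\<Sum>j\<le>n. (- 1) ^ j * of_nat (n choose j) * of_nat (j choose (n - l)) * of_nat (j choose m)) =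
    ((- 1) ^ n * of_nat (n choose l) * of_nat (if m < l then 0 else (n - l) choose (m - l))
      :: 'a::comm_ring_1)"
    (is "?lhs = _")
proof -
  let ?k = "n - l"
  let ?g = "\<lambda>j. (- 1) ^ j * of_nat (n choose j) * of_nat (j choose ?k) * of_nat (j choose m) :: 'a"
  \<comment> \<open>Terms with \<open>j < ?k\<close> vanish, and \<open>l + ?k = n\<close>.\<close>
  have "?lhs = (\<Sum>j\<in>{?k..l + ?k}. ?g j)"
    using assms by (intro sum.mono_neutral_right) (auto simp: binomial_eq_0)
  also have "\<dots> = (\<Sum>i\<le>l. ?g (i + ?k))"
    using sum.shift_bounds_cl_nat_ivl[of ?g 0 ?k l] by (simp add: atMost_atLeast0)
  also have "\<dots> = (\<Sum>i\<le>l. (- 1) ^ ?k * of_nat (n choose l) *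
      ((- 1) ^ i * of_nat (l choose i) * of_nat ((i + ?k) choose m)))"
  proof (intro sum.cong refl)
    fix i assume "i \<in> {..l}"
    then have "(n choose (i + ?k)) * ((i + ?k) choose ?k) = (n choose l) * (l choose i)"
      using assms choose_mult[of ?k "i + ?k" n] binomial_symmetric[of l n] by simp
    then have "of_nat (n choose (i + ?k)) * of_nat ((i + ?k) choose ?k) =
        (of_nat (n choose l) * of_nat (l choose i) :: 'a)"
      by (metis of_nat_mult)
    then show "?g (i + ?k) = (- 1) ^ ?k * of_nat (n choose l) *
      ((- 1) ^ i * of_nat (l choose i) * of_nat ((i + ?k) choose m))"
      by (simp add: power_add mult_ac)
  qed
  also have "\<dots> = (- 1) ^ ?k * of_nat (n choose l) *
      ((- 1) ^ l * of_nat (if m < l then 0 else ?k choose (m - l)))"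
    unfolding sum_distrib_left[symmetric] alternating_sum_choose_choose ..
  also have "\<dots> = (- 1) ^ (?k + l) * of_nat (n choose l) *
      of_nat (if m < l then 0 else ?k choose (m - l))"
    by (simp only: power_add mult_ac)
  finally show ?thesis using assms by simp
qed

theorem mainTheorem7:
  fixes \<alpha> :: complex and p n :: nat
  assumes "n \<ge> 1" and "p \<le> n"
  shows "(\<Sum>j = 0..n. of_nat (n choose j) * of_nat j ^ p * gen_harm \<alpha> j * (- 1) ^ j) =
    (\<Sum>l = 0..p. \<Sum>j = 0..p.
       if l = n then 0
       else (- 1) ^ l * of_nat (n choose l) * of_nat (shifted_binomial n j l) * fact j *
            of_nat (Stirling p j) * (1 / of_nat (n - l)) * ((1 - \<alpha>) ^ (n - l) - 1))"
proof -
  define g where "g k = ((1 - \<alpha>) ^ k - 1) / of_nat k" for k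
  define s where "s m = (of_nat (Stirling p m) * fact m :: complex)" for m
  have g0: "g 0 = 0" by (simp add: g_def)
  have harm: "gen_harm \<alpha> j = (\<Sum>l\<le>n. (- 1) ^ (n - l) * of_nat (j choose (n - l)) * g (n - l))"
    if "j \<le> n" for j
  proof -
    have "gen_harm \<alpha> j = (\<Sum>k\<le>j. (- 1) ^ k * of_nat (j choose k) * g k)"
      using gen_harm_binomial_transform[of "1 - \<alpha>" j] by (simp add: g_def)
    also have "\<dots> = (\<Sum>k\<le>n. (- 1) ^ k * of_nat (j choose k) * g k)"
      using that by (intro sum.mono_neutral_left) (auto simp: binomial_eq_0)
    \<comment> \<open>Reversing the order of summation substitutes \<open>k = n - l\<close>.\<close>
    finally show ?thesis
      by (subst sum.nat_diff_reindex[symmetric, of _ "Suc n", simplified lessThan_Suc_atMost])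
        (simp add: lessThan_Suc_atMost)
  qed
  have pow: "of_nat j ^ p = (\<Sum>m\<le>p. s m * of_nat (j choose m))" for j
    using arg_cong[OF power_eq_sum_Stirling_binomial[of j p], of "of_nat :: nat \<Rightarrow> complex"]
    by (simp add: s_def)
  have "(\<Sum>j = 0..n. of_nat (n choose j) * of_nat j ^ p * gen_harm \<alpha> j * (- 1) ^ j) =
      (\<Sum>j\<le>n. \<Sum>l\<le>n. \<Sum>m\<le>p. (- 1) ^ (n - l) * g (n - l) * s m *
        ((- 1) ^ j * of_nat (n choose j) * of_nat (j choose (n - l)) * of_nat (j choose m)))"
    unfolding atMost_atLeast0[symmetric]
  proof (intro sum.cong refl)
    fix j assume "j \<in> {..n}"
    then show "of_nat (n choose j) * of_nat j ^ p * gen_harm \<alpha> j * (- 1) ^ j =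
      (\<Sum>l\<le>n. \<Sum>m\<le>p. (- 1) ^ (n - l) * g (n - l) * s m *
        ((- 1) ^ j * of_nat (n choose j) * of_nat (j choose (n - l)) * of_nat (j choose m)))"
      unfolding pow by (simp add: harm sum_distrib_left sum_distrib_right mult_ac)
  qed
  also have "\<dots> = (\<Sum>l\<le>n. \<Sum>m\<le>p. \<Sum>j\<le>n. (- 1) ^ (n - l) * g (n - l) * s m *
        ((- 1) ^ j * of_nat (n choose j) * of_nat (j choose (n - l)) * of_nat (j choose m)))"
    by (rule trans[OF sum.swap], rule sum.cong[OF refl], rule sum.swap)
  also have "\<dots> = (\<Sum>l\<le>n. \<Sum>m\<le>p. (- 1) ^ l * of_nat (n choose l) *
        of_nat (shifted_binomial n m l) * s m * g (n - l))"
  proof (intro sum.cong refl)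
    fix l m assume "l \<in> {..n}"
    then have l: "l \<le> n" by simp
    \<comment> \<open>The exponents add up to \<open>2 * n - l\<close>, which has the parity of
      \<open>l\<close>.\<close>
    have sgn: "(- 1) ^ (n - l) * (- 1) ^ n = ((- 1) ^ l :: complex)"
      using l by (simp add: power_add[symmetric] minus_one_power_iff)
    have "(\<Sum>j\<le>n. (- 1) ^ (n - l) * g (n - l) * s m *
        ((- 1) ^ j * of_nat (n choose j) * of_nat (j choose (n - l)) * of_nat (j choose m))) =
        ((- 1) ^ (n - l) * (- 1) ^ n) * (g (n - l) * s m * of_nat (n choose l) *
          of_nat (shifted_binomial n m l))"
      unfolding sum_distrib_left[symmetric] alternating_sum_three_choose[OF l] shifted_binomial_def
      by (simp only: mult_ac)
    then show "(\<Sum>j\<le>n. (- 1) ^ (n - l) * g (n - l) * s m *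
        ((- 1) ^ j * of_nat (n choose j) * of_nat (j choose (n - l)) * of_nat (j choose m))) =
        (- 1) ^ l * of_nat (n choose l) * of_nat (shifted_binomial n m l) * s m * g (n - l)"
      unfolding sgn by (simp only: mult_ac)
  qed
  \<comment> \<open>For \<open>l > p\<close> every \<open>m \<le> p\<close> lies below
    \<open>l\<close>, so \<open>shifted_binomial n m l\<close> is 0.\<close>
  also have "\<dots> = (\<Sum>l\<le>p. \<Sum>m\<le>p. (- 1) ^ l * of_nat (n choose l) *
        of_nat (shifted_binomial n m l) * s m * g (n - l))"
    using assms(2) by (intro sum.mono_neutral_right) (auto simp: shifted_binomial_def)
  also have "\<dots> = (\<Sum>l = 0..p. \<Sum>j = 0..p.
       if l = n then 0
       else (- 1) ^ l * of_nat (n choose l) * of_nat (shifted_binomial n j l) * fact j *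
            of_nat (Stirling p j) * (1 / of_nat (n - l)) * ((1 - \<alpha>) ^ (n - l) - 1))"
    \<comment> \<open>The case \<open>l = n\<close> agrees with the stated convention because
      \<open>g 0 = 0\<close>.\<close>
    unfolding atMost_atLeast0 by (intro sum.cong refl) (auto simp: g0 s_def g_def)
  finally show ?thesis .
qed

end
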